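(* Let $D$ be a digraph of order $n$ and let $W\subseteq V(D)$ be nonempty. If $\delta^0(W)\geq n/2$, then $W$ is cyclable, i.e. $D$ contains a directed cycle $C$ with $W\subseteq V(C)$.
   Context: Digraphs are finite and simple: no loops and no multiple arcs, but both arcs $uv$ and $vu$ may be present. The order of $D$ is $|V(D)|$. A cycle in a digraph means a directed cycle; directed cycles of length $2$ are allowed. For $v\in V(D)$, $d^+_D(v)$ and $d^-_D(v)$ denote the out-degree and in-degree of $v$ in $D$. For nonempty $W\subseteq V(D)$, $\delta^+(W)=\min\{d^+_D(v): v\in W\}$, $\delta^-(W)=\min\{d^-_D(v): v\in W\}$, and $\delta^0(W)=\min\{\delta^+(W),\delta^-(W)\}$ (degrees are taken in the whole of $D$). A set $W$ is cyclable if some single directed cycle of $D$ contains all vertices of $W$. *)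

theory Defs
  imports Complex_Main "Graph_Theory.Graph_Theory"
begin

text \<open>The three degree minima below are meaningful only for finite nonempty \<open>W\<close>,
  since they rest on \<open>Min\<close>.\<close>

definition min_out_degree :: "('a, 'b) pre_digraph \<Rightarrow> 'a set \<Rightarrow> nat" where
  "min_out_degree G W = Min (out_degree G ` W)"

definition min_in_degree :: "('a, 'b) pre_digraph \<Rightarrow> 'a set \<Rightarrow> nat" where
  "min_in_degree G W = Min (in_degree G ` W)"

definition min_semidegree :: "('a, 'b) pre_digraph \<Rightarrow> 'a set \<Rightarrow> nat" where
  "min_semidegree G W = min (min_out_degree G W) (min_in_degree G W)"

text \<open>A cycle \<open>p\<close> is a nonempty arc list, so \<open>awalk_verts G u p\<close> does not depend on \<open>u\<close>.
  In a loop-free digraph every cycle has length at least 2, and length 2 is allowed.\<close>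

definition cyclable :: "('a, 'b) pre_digraph \<Rightarrow> 'a set \<Rightarrow> bool" where
  "cyclable G W \<longleftrightarrow>
    (\<exists>u p. pre_digraph.cycle G p \<and> W \<subseteq> set (pre_digraph.awalk_verts G u p))"

end

theory Submission
  imports Defs
begin

text \<open>Induction on \<open>W\<close>: let a cycle \<open>C\<close> contain all of \<open>W\<close> but not \<open>w\<close>, and let \<open>T\<close> be the
  set of vertices other than \<open>w\<close> that lie off \<open>C\<close>. From some vertices of \<open>C\<close> one can reach \<open>w\<close>,
  and from \<open>w\<close> one can reach some vertices of \<open>C\<close>, directly or through one vertex of \<open>T\<close>. Choose
  such a detour around the shortest possible segment \<open>M\<close> of \<open>C\<close>. Since no detour leaves or
  enters inside \<open>M\<close>, the vertices of \<open>W\<close> in \<open>M\<close> have few neighbours in \<open>T\<close>, hence many on \<open>C\<close>,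
  and all of them can be inserted into the rest of \<open>C\<close>. The detour closes the resulting path
  to a cycle.\<close>

section \<open>Counting along lists\<close>

text \<open>Each consecutive pair contributes at most 1: its first entry in \<open>A\<close> or its
  second in \<open>B\<close>. Only the head in \<open>B\<close> and the last entry in
  \<open>A\<close> remain uncounted, whence the \<open>+ 1\<close>.\<close>

lemma card_le_if_no_consecutive:
  assumes "distinct xs" "successively (\<lambda>x y. \<not> (x \<in> A \<and> y \<in> B)) xs"
  shows "card (A \<inter> set xs) + card (B \<inter> set xs) \<le> length xs + 1"
proof -
  \<comment> \<open>Strengthened for the induction: the excess over the length is charged to the
    head.\<close>
  have "length (filter (\<lambda>x. x \<in> A) xs) + length (filter (\<lambda>x. x \<in> B) xs)
      \<le> length xs + (if xs \<noteq> [] \<and> hd xs \<in> B then 1 else 0)"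
    using assms(2)
  proof (induction xs)
    case (Cons x xs)
    then show ?case by (cases xs) (auto split: if_splits)
  qed simp
  then show ?thesis
    using assms(1) by (simp add: distinct_length_filter split: if_splits)
qed

lemma not_successivelyE:
  assumes "\<not> successively P xs"
  obtains ys x y zs where "xs = ys @ [x, y] @ zs" "\<not> P x y"
  using assms
proof (induction xs arbitrary: thesis)
  case (Cons a xs)
  show ?case
  proof (cases "successively P xs")
    case True
    then obtain b xs' where "xs = b # xs'" "\<not> P a b"
      using Cons.prems(2) by (cases xs) auto
    then show ?thesis using Cons.prems(1)[of "[]" a b xs'] by simp
  next
    case False
    from Cons.IH[OF _ this] obtain ys x y zs where "xs = ys @ [x, y] @ zs" "\<not> P x y"
      by blast
    then show ?thesis using Cons.prems(1)[of "a # ys" x y zs] by simp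
  qed
qed simp

section \<open>Vertex cycles and large neighbourhoods\<close>

text \<open>Vertex lists make cutting and splicing plain list operations. A singleton would need a
  loop, so irreflexivity of \<open>E\<close> forces length at least 2.\<close>

definition vertex_cycle :: "('a \<Rightarrow> 'a \<Rightarrow> bool) \<Rightarrow> 'a list \<Rightarrow> bool" where
  "vertex_cycle E xs \<longleftrightarrow> xs \<noteq> [] \<and> distinct xs \<and> successively E (xs @ [hd xs])"

lemma vertex_cycle_swap:
  assumes "vertex_cycle E (xs @ ys)"
  shows "vertex_cycle E (ys @ xs)"
  using assms
  by (cases "xs = []"; cases "ys = []") (auto simp: vertex_cycle_def successively_append_iff)

locale loopfree_relation =
  fixes V :: "'a set" and E :: "'a \<Rightarrow> 'a \<Rightarrow> bool"
  assumes finite_V: "finite V"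
    and E_in_V: "E x y \<Longrightarrow> x \<in> V \<and> y \<in> V"
    and irrefl: "\<not> E x x"
begin

definition out_nbs :: "'a \<Rightarrow> 'a set" where "out_nbs v = {y. E v y}"
definition in_nbs :: "'a \<Rightarrow> 'a set" where "in_nbs v = {x. E x v}"

definition half_degree :: "'a \<Rightarrow> bool" where
  "half_degree v \<longleftrightarrow> card V \<le> 2 * card (out_nbs v) \<and> card V \<le> 2 * card (in_nbs v)"

lemma out_nbs_subset: "out_nbs v \<subseteq> V - {v}" and in_nbs_subset: "in_nbs v \<subseteq> V - {v}"
  using E_in_V irrefl by (auto simp: out_nbs_def in_nbs_def)

lemma finite_nbs [simp]: "finite (out_nbs v)" "finite (in_nbs v)"
  using out_nbs_subset in_nbs_subset finite_V by (meson finite_Diff finite_subset)+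

lemma vertex_cycle_subset: "vertex_cycle E C \<Longrightarrow> set C \<subseteq> V"
proof
  fix x assume C: "vertex_cycle E C" and x: "x \<in> set C"
  then obtain ys zs where "C = ys @ x # zs" by (meson split_list)
  then have "\<exists>y. E x y"
    using C by (cases zs) (auto simp: vertex_cycle_def successively_append_iff)
  then show "x \<in> V" using E_in_V by blast
qed

text \<open>Without the arc from \<open>u\<close> to \<open>v\<close>, both neighbourhoods avoid
  \<open>u\<close> and \<open>v\<close>. Their sizes add up to at least \<open>card V\<close>, but
  their union has at most \<open>card V - 2\<close> elements.\<close>

lemma common_nbs:
  assumes "half_degree u" "half_degree v" "u \<in> V" "v \<in> V" "u \<noteq> v" "\<not> E u v"
  shows "2 \<le> card (out_nbs u \<inter> in_nbs v)"
proof -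
  have "out_nbs u \<union> in_nbs v \<subseteq> V - {u, v}"
    using out_nbs_subset[of u] in_nbs_subset[of v] assms(6) by (auto simp: out_nbs_def in_nbs_def)
  then have "card (out_nbs u \<union> in_nbs v) \<le> card (V - {u, v})"
    using finite_V by (intro card_mono) auto
  also have "\<dots> = card V - 2"
    using assms(3-5) finite_V by (subst card_Diff_subset) auto
  finally have "card (out_nbs u \<union> in_nbs v) \<le> card V - 2" .
  moreover have "2 \<le> card V"
    using card_mono[OF finite_V, of "{u, v}"] assms(3-5) by auto
  moreover have "card V \<le> card (out_nbs u) + card (in_nbs v)"
    using assms(1,2) by (auto simp: half_degree_def)
  ultimately show ?thesis
    using card_Un_Int[of "out_nbs u" "in_nbs v"] by simp
qed

lemma cycle_through_vertex:
  assumes "half_degree w" "w \<in> V"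
  shows "\<exists>C. vertex_cycle E C \<and> w \<in> set C"
proof -
  have "out_nbs w \<inter> in_nbs w \<noteq> {}"
  proof
    assume "out_nbs w \<inter> in_nbs w = {}"
    then have "card (out_nbs w) + card (in_nbs w) = card (out_nbs w \<union> in_nbs w)"
      by (simp add: card_Un_disjoint)
    also have "\<dots> \<le> card (V - {w})"
      using finite_V out_nbs_subset in_nbs_subset by (intro card_mono) auto
    also have "\<dots> < card V"
      using assms(2) finite_V by (rule card_Diff1_less[rotated])
    finally show False using assms(1) by (auto simp: half_degree_def)
  qed
  then obtain x where "E w x" "E x w" by (auto simp: out_nbs_def in_nbs_def)
  then have "vertex_cycle E [w, x]" using irrefl by (auto simp: vertex_cycle_def)
  then show ?thesis by (intro exI[of _ "[w, x]"]) simp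
qed

section \<open>Absorbing vertices into paths and cycles\<close>

text \<open>Among the paths in \<open>S\<close> that keep the ends and vertices of \<open>P\<close>,
  a longest one has no room for a further \<open>v\<close> between consecutive vertices, so the
  counting lemma applies.\<close>

lemma longest_path:
  assumes "finite S" "P \<noteq> []" "distinct P" "successively E P" "set P \<subseteq> S"
  obtains Q where "Q \<noteq> []" "distinct Q" "successively E Q" "set P \<subseteq> set Q" "set Q \<subseteq> S"
    "hd Q = hd P" "last Q = last P"
    "\<And>v. v \<in> S - set Q \<Longrightarrow>
      card (in_nbs v \<inter> set Q) + card (out_nbs v \<inter> set Q) \<le> length Q + 1"
proof -
  define path where "path Q \<longleftrightarrow> Q \<noteq> [] \<and> distinct Q \<and> successively E Q \<and> set P \<subseteq> set Q \<and>
    set Q \<subseteq> S \<and> hd Q = hd P \<and> last Q = last P" for Q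
  have "path P" using assms by (simp add: path_def)
  moreover have "length Q < Suc (card S)" if "path Q" for Q
    using that card_mono[OF assms(1), of "set Q"] distinct_card[of Q] by (auto simp: path_def)
  ultimately obtain Q where Q: "path Q" and max: "\<And>R. path R \<Longrightarrow> length R \<le> length Q"
    using ex_has_greatest_nat[of path P length] by (metis less_imp_le)
  have "card (in_nbs v \<inter> set Q) + card (out_nbs v \<inter> set Q) \<le> length Q + 1"
    if v: "v \<in> S - set Q" for v
  proof (rule card_le_if_no_consecutive)
    show "successively (\<lambda>x y. \<not> (x \<in> in_nbs v \<and> y \<in> out_nbs v)) Q"
    proof (rule ccontr)
      assume "\<not> ?thesis"
      then obtain ys x y zs where xy: "Q = ys @ [x, y] @ zs" "E x v" "E v y"
        by (elim not_successivelyE) (auto simp: in_nbs_def out_nbs_def)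
      have "path (ys @ [x, v, y] @ zs)"
        using Q v xy by (auto simp: path_def successively_append_iff hd_append)
      from max[OF this] show False using xy by simp
    qed
  qed (use Q in \<open>simp add: path_def\<close>)
  then show ?thesis using Q that[of Q] unfolding path_def by blast
qed

text \<open>The asymmetry between \<open>A2\<close> (two connecting vertices) and \<open>B1\<close> (one) in the
  proof below makes every pair in \<open>A2 \<times> B1\<close> usable, while a vertex outside both sets
  has at most one arc into \<open>A \<inter> T\<close> and none from \<open>B \<inter> T\<close>.\<close>
lemma extend_cycle:
  assumes "w \<in> V" and "W \<subseteq> V" and "W \<noteq> {}"
    and half: "\<And>v. v \<in> insert w W \<Longrightarrow> half_degree v"
    and C: "vertex_cycle E C" "W \<subseteq> set C"
  shows "\<exists>C'. vertex_cycle E C' \<and> insert w W \<subseteq> set C'"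
proof (cases "w \<in> set C")
  case True
  then show ?thesis using C by blast
next
  case w: False
  define T where "T = V - set C - {w}"
  define A where "A = in_nbs w"
  define B where "B = out_nbs w"
  define A2 where "A2 = {c \<in> set C. c \<in> A \<or> 2 \<le> card (out_nbs c \<inter> A \<inter> T)}"
  define B1 where "B1 = {c \<in> set C. c \<in> B \<or> in_nbs c \<inter> B \<inter> T \<noteq> {}}"
  have C_V: "set C \<subseteq> V" using C(1) by (rule vertex_cycle_subset)
  have dC: "distinct C" using C(1) by (simp add: vertex_cycle_def)
  have fin: "finite T" "finite A" "finite B"
    using finite_V by (auto simp: T_def A_def B_def)
  have V_eq: "V = insert w (set C \<union> T)" using C_V assms(1) by (auto simp: T_def)
  have card_V: "card V = length C + card T + 1"
  proof -
    have "card V = Suc (card (set C \<union> T))"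
      unfolding V_eq using w fin by (subst card_insert_disjoint) (auto simp: T_def)
    also have "card (set C \<union> T) = card (set C) + card T"
      using fin by (subst card_Un_disjoint) (auto simp: T_def)
    finally show ?thesis using dC by (simp add: distinct_card)
  qed
  have nbs: "A \<subseteq> set C \<union> T" "B \<subseteq> set C \<union> T"
    using V_eq in_nbs_subset[of w] out_nbs_subset[of w] by (auto simp: A_def B_def)

  obtain u where u: "u \<in> W" using assms(3) by blast
  have u': "u \<in> set C" "u \<in> V" "u \<noteq> w" "half_degree u" "half_degree w"
    using u C(2) assms(2) w half by auto
  \<comment> \<open>If no vertex of \<open>C\<close> has an arc to \<open>w\<close>, then
    \<open>A\<close> lies in \<open>T\<close>, and any \<open>u\<close> in \<open>W\<close> has two
    connecting vertices there. The argument for \<open>B1\<close> is dual.\<close>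
  have "\<exists>a. a \<in> A2"
  proof (cases "A \<inter> set C = {}")
    case True
    then have "A \<subseteq> T" "\<not> E u w" using nbs u'(1) by (auto simp: A_def in_nbs_def)
    then have "2 \<le> card (out_nbs u \<inter> A \<inter> T)"
      using common_nbs[of u w] u' assms(1) by (simp add: A_def Int_absorb2 inf.assoc)
    then show ?thesis using u'(1) by (auto simp: A2_def)
  qed (auto simp: A2_def)
  then obtain a where a: "a \<in> A2" ..
  have "\<exists>b. b \<in> B1"
  proof (cases "B \<inter> set C = {}")
    case True
    then have "B \<subseteq> T" "\<not> E w u" using nbs u'(1) by (auto simp: B_def out_nbs_def)
    then have "out_nbs w \<inter> in_nbs u \<noteq> {}"
      using common_nbs[of w u] u' assms(1) by force
    then have "in_nbs u \<inter> B \<inter> T \<noteq> {}"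
      using \<open>B \<subseteq> T\<close> by (auto simp: B_def)
    then show ?thesis using u'(1) by (auto simp: B1_def)
  qed (auto simp: B1_def)
  then obtain b where b: "b \<in> B1" ..

  have connect: "\<exists>ca cb. set ca \<union> set cb \<subseteq> T \<and> distinct (ca @ cb) \<and>
      successively E (a # ca @ [w] @ cb @ [b])" if a: "a \<in> A2" and b: "b \<in> B1" for a b
  proof -
    \<comment> \<open>The exit from \<open>w\<close> is chosen first. It uses at most one vertex of
      \<open>T\<close>, so one of the two candidates for the entry stays free.\<close>
    obtain cb where cb: "set cb \<subseteq> T" "distinct cb" "length cb \<le> 1" "successively E ([w] @ cb @ [b])"
    proof (cases "E w b")
      case True
      then show ?thesis using that[of "[]"] by simp
    next
      case False
      then obtain y where "y \<in> T" "E w y" "E y b"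
        using b by (auto simp: B1_def B_def out_nbs_def in_nbs_def)
      then show ?thesis using that[of "[y]"] by simp
    qed
    obtain ca where ca: "set ca \<subseteq> T - set cb" "distinct ca" "successively E (a # ca @ [w])"
    proof (cases "E a w")
      case True
      then show ?thesis using that[of "[]"] by simp
    next
      case False
      then have "2 \<le> card (out_nbs a \<inter> A \<inter> T)"
        using a by (auto simp: A2_def A_def in_nbs_def)
      then have "\<not> out_nbs a \<inter> A \<inter> T \<subseteq> set cb"
        using card_mono[of "set cb" "out_nbs a \<inter> A \<inter> T"] card_length[of cb] cb(3) by auto
      then obtain x where "x \<in> T - set cb" "E a x" "E x w"
        by (auto simp: A_def out_nbs_def in_nbs_def)
      then show ?thesis using that[of "[x]"] by simp
    qed
    have "successively E ((a # ca @ [w]) @ cb @ [b])"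
      using ca(3) cb(4) unfolding successively_append_iff[of E "a # ca @ [w]"]
      by (simp add: successively_Cons)
    then show ?thesis using ca cb by (intro exI[of _ ca] exI[of _ cb]) auto
  qed

  define rotation where "rotation P M \<longleftrightarrow> P \<noteq> [] \<and> vertex_cycle E (P @ M) \<and>
    set (P @ M) = set C \<and> hd P \<in> B1 \<and> last P \<in> A2" for P M
  \<comment> \<open>Rotate \<open>C\<close> to start at \<open>b\<close> and cut it just after
    \<open>a\<close>; \<open>a = b\<close> is allowed.\<close>
  have "\<exists>P M. rotation P M"
  proof -
    obtain ys zs where ys: "C = ys @ b # zs" using b split_list[of b C] by (auto simp: B1_def)
    have cyc: "vertex_cycle E ((b # zs) @ ys)" using C(1) ys vertex_cycle_swap by blast
    have "a \<in> set ((b # zs) @ ys)" using a ys by (auto simp: A2_def)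
    then obtain ps M where ps: "(b # zs) @ ys = ps @ a # M" by (meson split_list)
    have "hd (ps @ [a]) = b" using ps by (cases ps) auto
    moreover have "set ((b # zs) @ ys) = set C" using ys by auto
    ultimately have "rotation (ps @ [a]) M"
      using cyc a b unfolding rotation_def ps by auto
    then show ?thesis by blast
  qed
  then obtain P M where PM: "rotation P M"
    and least: "\<And>P' M'. rotation P' M' \<Longrightarrow> length M \<le> length M'"
    using arg_min_nat_lemma[of "\<lambda>(P, M). rotation P M" _ "\<lambda>(P, M). length M"]
    by (metis (mono_tags, lifting) case_prod_conv surj_pair)
  have P: "P \<noteq> []" "distinct P" "successively E P" "set P \<subseteq> set C" and cPM: "vertex_cycle E (P @ M)"
    using PM by (auto simp: rotation_def vertex_cycle_def successively_append_iff)
  obtain Q where Q: "Q \<noteq> []" "distinct Q" "successively E Q" "set P \<subseteq> set Q" "set Q \<subseteq> set C"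
    "hd Q = hd P" "last Q = last P"
    and deg_Q: "\<And>v. v \<in> set C - set Q \<Longrightarrow>
      card (in_nbs v \<inter> set Q) + card (out_nbs v \<inter> set Q) \<le> length Q + 1"
    using longest_path[of "set C" P] P by blast

  have "W \<subseteq> set Q"
  proof (rule ccontr)
    assume "\<not> W \<subseteq> set Q"
    then obtain v where v: "v \<in> W" "v \<in> set C" "v \<notin> set Q" using C(2) by blast
    have M_PM: "x \<in> set M" if "x \<in> set C" "x \<notin> set P" for x
      using PM that by (auto simp: rotation_def)
    have vM: "v \<in> set M" using v Q(4) M_PM by blast
    \<comment> \<open>A vertex of \<open>A2\<close> in \<open>M\<close> could serve as a later end
      of \<open>P\<close>, and one of \<open>B1\<close> as an earlier start; both would shorten
      \<open>M\<close>.\<close>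
    have M_A2: "x \<notin> A2" if x: "x \<in> set M" for x
    proof
      assume "x \<in> A2"
      obtain M1 M2 where M: "M = M1 @ x # M2" using x by (meson split_list)
      have "rotation (P @ M1 @ [x]) M2"
        using PM \<open>x \<in> A2\<close> M by (auto simp: rotation_def)
      from least[OF this] show False using M by simp
    qed
    have M_B1: "x \<notin> B1" if x: "x \<in> set M" for x
    proof
      assume "x \<in> B1"
      obtain M1 M2 where M: "M = M1 @ x # M2" using x by (meson split_list)
      have "vertex_cycle E ((x # M2) @ P @ M1)"
        using vertex_cycle_swap[of E "P @ M1" "x # M2"] cPM M by simp
      then have "rotation (x # M2 @ P) M1"
        using PM \<open>x \<in> B1\<close> M by (auto simp: rotation_def)
      from least[OF this] show False using M by simp
    qed
    \<comment> \<open>Cutting the cycle between consecutive vertices of \<open>P\<close> in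
      \<open>A2\<close> and \<open>B1\<close> would give an empty bypassed segment, although
      \<open>M\<close> contains \<open>v\<close>.\<close>
    have "card (A2 \<inter> set P) + card (B1 \<inter> set P) \<le> length P + 1"
    proof (rule card_le_if_no_consecutive)
      show "successively (\<lambda>x y. \<not> (x \<in> A2 \<and> y \<in> B1)) P"
      proof (rule ccontr)
        assume "\<not> ?thesis"
        then obtain ys x y zs where xy: "P = ys @ [x, y] @ zs" "x \<in> A2" "y \<in> B1"
          by (elim not_successivelyE) auto
        have "vertex_cycle E ((y # zs @ M) @ ys @ [x])"
          using vertex_cycle_swap[of E "ys @ [x]" "y # zs @ M"] cPM xy by simp
        then have "rotation (y # zs @ M @ ys @ [x]) []"
          using PM xy by (auto simp: rotation_def)
        from least[OF this] show False using vM by simp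
      qed
    qed (fact P)
    moreover have "card A \<le> card (A2 \<inter> set P) + card (A \<inter> T)"
    proof -
      have "A \<subseteq> (A2 \<inter> set P) \<union> (A \<inter> T)" using nbs M_A2 M_PM by (auto simp: A2_def)
      from card_mono[OF _ this] show ?thesis using fin
        by (meson card_Un_le finite_Int finite_UnI finite_set le_trans)
    qed
    moreover have "card B \<le> card (B1 \<inter> set P) + card (B \<inter> T)"
    proof -
      have "B \<subseteq> (B1 \<inter> set P) \<union> (B \<inter> T)" using nbs M_B1 M_PM by (auto simp: B1_def)
      from card_mono[OF _ this] show ?thesis using fin
        by (meson card_Un_le finite_Int finite_UnI finite_set le_trans)
    qed
    moreover have "card V \<le> card A + card B" "card V \<le> card (in_nbs v) + card (out_nbs v)"
      using half[of w] half[of v] v by (auto simp: half_degree_def A_def B_def)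
    \<comment> \<open>As \<open>v\<close> is outside \<open>B1\<close>, no arc enters it from
      \<open>B \<inter> T\<close>. Being outside \<open>A2\<close> still allows one arc into
      \<open>A \<inter> T\<close>, hence the \<open>+ 1\<close> in the next bound.\<close>
    moreover have "card (in_nbs v) \<le> card (in_nbs v \<inter> set Q) + card (set C - set Q - {v}) + card (T - B)"
    proof -
      have "in_nbs v \<inter> B \<inter> T = {}" "\<not> E w v"
        using M_B1[OF vM] v(2) by (auto simp: B1_def B_def out_nbs_def)
      then have "in_nbs v \<subseteq> (in_nbs v \<inter> set Q) \<union> (set C - set Q - {v}) \<union> (T - B)"
        using in_nbs_subset[of v] V_eq by (auto simp: in_nbs_def)
      from card_mono[OF _ this] show ?thesis using fin
        by (smt (verit, best) add.commute add_mono_thms_linordered_semiring(3) card_Un_le finite_Diff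
            finite_Int finite_UnI finite_set le_trans)
    qed
    moreover have "card (out_nbs v) \<le> card (out_nbs v \<inter> set Q) + card (set C - set Q - {v})
        + (card (T - A) + 1)"
    proof -
      have 1: "card (out_nbs v \<inter> A \<inter> T) \<le> 1" and "\<not> E v w"
        using M_A2[OF vM] v(2) by (auto simp: A2_def A_def in_nbs_def)
      then have "out_nbs v \<subseteq> (out_nbs v \<inter> set Q) \<union> (set C - set Q - {v}) \<union>
          ((T - A) \<union> (out_nbs v \<inter> A \<inter> T))"
        using out_nbs_subset[of v] V_eq by (auto simp: out_nbs_def)
      from card_mono[OF _ this] have "card (out_nbs v) \<le> card \<dots>" using fin by simp
      also have "\<dots> \<le> card (out_nbs v \<inter> set Q) + card (set C - set Q - {v})
          + (card (T - A) + card (out_nbs v \<inter> A \<inter> T))"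
        by (intro order_trans[OF card_Un_le] add_mono card_Un_le)
      finally show ?thesis using 1 by linarith
    qed
    moreover have "card (in_nbs v \<inter> set Q) + card (out_nbs v \<inter> set Q) \<le> length Q + 1"
      using deg_Q v by blast
    moreover have "card (set C - set Q - {v}) + length Q + 1 = length C"
    proof -
      have "card (set C) = card (set C - set Q) + card (set Q)"
        using Q(5) by (simp add: card_Diff_subset card_mono)
      moreover have "card (set C - set Q) = Suc (card (set C - set Q - {v}))"
        using v by (metis Diff_iff card_Suc_Diff1 finite_Diff finite_set)
      ultimately show ?thesis using dC Q(2) by (simp add: distinct_card)
    qed
    moreover have "card (T - A) + card (A \<inter> T) = card T" "card (T - B) + card (B \<inter> T) = card T"
      using fin by (metis Int_commute add.commute card_Int_Diff)+
    moreover have "length P \<le> length Q"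
      using card_mono[OF _ Q(4)] P(2) Q(2) by (simp add: distinct_card)
    \<comment> \<open>The four degrees sum to at least \<open>2 * card V\<close>, while the bounds
      give at most \<open>2 * length C + 2 * card T + 1\<close>, which is
      \<open>2 * card V - 1\<close>.\<close>
    ultimately show False using card_V by linarith
  qed

  obtain ca cb where c: "set ca \<union> set cb \<subseteq> T" "distinct (ca @ cb)"
    "successively E (last Q # ca @ [w] @ cb @ [hd Q])"
    using connect[of "last Q" "hd Q"] PM Q(6,7) by (auto simp: rotation_def)
  \<comment> \<open>The detour meets \<open>Q\<close> only at its two ends, since \<open>T\<close>
    and \<open>w\<close> lie off \<open>C\<close>.\<close>
  have "vertex_cycle E (Q @ ca @ [w] @ cb)"
  proof -
    have "successively E (Q @ ca @ [w] @ cb @ [hd Q])"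
      using c(3) Q(1,3) by (subst successively_append_iff) (auto simp: successively_Cons)
    then show ?thesis
      using Q(1,2,5) c(1,2) w by (auto simp: vertex_cycle_def T_def)
  qed
  then show ?thesis using \<open>W \<subseteq> set Q\<close> by (intro exI[of _ "Q @ ca @ [w] @ cb"]) auto
qed

lemma exists_cycle_through:
  assumes "W \<subseteq> V" "W \<noteq> {}" "\<And>v. v \<in> W \<Longrightarrow> half_degree v"
  shows "\<exists>C. vertex_cycle E C \<and> W \<subseteq> set C"
proof -
  have "finite W" using assms(1) finite_V by (rule finite_subset)
  then show ?thesis using assms(2,1,3)
  proof (induction rule: finite_ne_induct)
    case (singleton w)
    then show ?case using cycle_through_vertex by auto
  next
    case (insert w W)
    then obtain C where "vertex_cycle E C" "W \<subseteq> set C" by blast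
    then show ?case using insert by (intro extend_cycle) auto
  qed
qed

end

section \<open>Transfer to digraphs\<close>

lemma (in wf_digraph) awalk_along:
  assumes "successively (\<lambda>x y. x \<rightarrow> y) (u # xs @ [v])"
  shows "\<exists>p. awalk u p v \<and> awalk_verts u p = u # xs @ [v] \<and> p \<noteq> []"
  using assms
proof (induction xs arbitrary: u)
  case Nil
  then obtain e where "e \<in> arcs G" "tail G e = u" "head G e = v" by auto
  then have "awalk u [e] v \<and> awalk_verts u [e] = u # [] @ [v] \<and> [e] \<noteq> []"
    by (auto simp: awalk_def)
  then show ?case by blast
next
  case (Cons x xs)
  then obtain p where p: "awalk x p v" "awalk_verts x p = x # xs @ [v]" by auto
  from Cons.prems obtain e where "e \<in> arcs G" "tail G e = u" "head G e = x" by auto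
  then have "awalk u (e # p) v \<and> awalk_verts u (e # p) = u # (x # xs) @ [v] \<and> e # p \<noteq> []"
    using p by (auto simp: awalk_def)
  then show ?case by blast
qed

text \<open>Without multiple arcs, \<open>head G\<close> is injective on the arcs leaving
  \<open>v\<close>, and \<open>tail G\<close> on those entering it.\<close>

lemma (in nomulti_digraph) degree_eq_card:
  "out_degree G v = card {y. v \<rightarrow> y}" "in_degree G v = card {x. x \<rightarrow> v}"
proof -
  have "{y. v \<rightarrow> y} = head G ` out_arcs G v" "{x. x \<rightarrow> v} = tail G ` in_arcs G v"
    by (auto simp: arcs_ends_conv)
  moreover have "inj_on (head G) (out_arcs G v)" "inj_on (tail G) (in_arcs G v)"
    by (auto simp: inj_on_def arc_to_ends_def intro: no_multi_arcs)
  ultimately show "out_degree G v = card {y. v \<rightarrow> y}" "in_degree G v = card {x. x \<rightarrow> v}"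
    by (simp_all add: out_degree_def in_degree_def card_image)
qed

theorem theorem1:
  fixes D :: "('a, 'b) pre_digraph" and W :: "'a set"
  assumes "digraph D"
    and "W \<subseteq> verts D"
    and "W \<noteq> {}"
    and "real (min_semidegree D W) \<ge> real (card (verts D)) / 2"
  shows "cyclable D W"
proof -
  interpret digraph D by fact
  interpret R: loopfree_relation "verts D" "\<lambda>x y. x \<rightarrow>\<^bsub>D\<^esub> y"
    by unfold_locales (auto dest: adj_in_verts adj_not_same)
  have "R.half_degree v" if "v \<in> W" for v
  proof -
    have "finite W" using assms(2) finite_verts by (rule finite_subset)
    then have "min_semidegree D W \<le> out_degree D v" "min_semidegree D W \<le> in_degree D v"
      using that by (auto simp: min_semidegree_def min_out_degree_def min_in_degree_def
          min.coboundedI1 min.coboundedI2)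
    moreover have "card (verts D) \<le> 2 * min_semidegree D W" using assms(4) by linarith
    ultimately show ?thesis
      unfolding R.half_degree_def R.out_nbs_def R.in_nbs_def degree_eq_card by linarith
  qed
  with assms(2,3) obtain C where C: "vertex_cycle (\<lambda>x y. x \<rightarrow>\<^bsub>D\<^esub> y) C" "W \<subseteq> set C"
    using R.exists_cycle_through by blast
  then obtain u xs where u: "C = u # xs" by (cases C) (auto simp: vertex_cycle_def)
  then obtain p where p: "awalk u p u" "awalk_verts u p = u # xs @ [u]" "p \<noteq> []"
    using awalk_along[of u xs u] C(1) by (auto simp: vertex_cycle_def)
  \<comment> \<open>The tail of the vertex sequence is \<open>xs @ [u]\<close>, a rotation of the
    distinct list \<open>C\<close>.\<close>
  have "cycle p" unfolding cycle_def using p C(1) u by (auto simp: vertex_cycle_def)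
  then show ?thesis unfolding cyclable_def using C(2) p u by (intro exI[of _ u] exI[of _ p]) auto
qed

end
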